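(* Let $T$ be a tree on $n\ge 2$ vertices that is not a corona (i.e. $T$ is not isomorphic to the corona of any graph). Then $c_4(T) > n/2 + 1$.
   Context: All graphs are finite, simple and undirected. A coloring of a graph assigns a color to each vertex and need not be proper. A subgraph (not necessarily induced) is rainbow if all its vertices receive pairwise different colors. $P_4$ is the path on $4$ vertices. $c_4(G)$ is the maximum number of different colors used in a (not necessarily proper) coloring of the vertices of $G$ having no rainbow subgraph isomorphic to $P_4$. The corona of a graph is obtained by taking the graph and, for each vertex $w$ of it, adding one new vertex adjacent only to $w$; this doubles the number of vertices. In particular $K_2$ is the corona of the one-vertex graph. *)

theory Defs
  imports Complex_Main "Graph_Theory.Graph_Theory"
begin

text \<open>
  A finite simple undirected graph is a \<^locale>\<open>pair_graph\<close>: finite, loop-free, without parallel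
  arcs, each edge being represented by its two opposite arcs.
\<close>

text \<open>
  The library predicate \<^const>\<open>tree\<close> is unsuitable for symmetric digraphs, since it counts the
  closed walk back and forth along a single edge as a cycle. In a \<^locale>\<open>pair_graph\<close>, the cycles
  of length at least three are exactly the cycles of the undirected graph.
\<close>

definition undirected_tree :: "'a pair_pre_digraph \<Rightarrow> bool" where
  "undirected_tree G \<longleftrightarrow>
     pair_graph G \<and> connected (with_proj G) \<and>
     \<not> (\<exists>p. pre_digraph.cycle (with_proj G) p \<and> length p \<ge> 3)"

definition path_graph :: "nat \<Rightarrow> nat pair_pre_digraph" where
  "path_graph k = \<lparr> pverts = {..<k},
     parcs = {(i, j). i < k \<and> j < k \<and> (j = Suc i \<or> i = Suc j)} \<rparr>"

definition rainbow :: "('a \<Rightarrow> 'c) \<Rightarrow> 'a pair_pre_digraph \<Rightarrow> bool" where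
  "rainbow c H \<longleftrightarrow> inj_on c (pverts H)"

definition no_rainbow_path :: "nat \<Rightarrow> 'a pair_pre_digraph \<Rightarrow> ('a \<Rightarrow> 'c) \<Rightarrow> bool" where
  "no_rainbow_path k G c \<longleftrightarrow>
     \<not> (\<exists>H :: 'a pair_pre_digraph. subgraph (with_proj H) (with_proj G) \<and>
       digraph_iso (with_proj (path_graph k)) (with_proj H) \<and> rainbow c H)"

text \<open>
  Natural numbers serve as colors; the lemma \<open>card_colors_le_c4\<close> below shows that colors from
  other types give nothing larger.
\<close>

definition c4 :: "'a pair_pre_digraph \<Rightarrow> nat" where
  "c4 G = Max {card (c ` pverts G) | c :: 'a \<Rightarrow> nat. no_rainbow_path 4 G c}"

text \<open>The vertices \<open>Inl w\<close> form the original graph, and \<open>Inr w\<close> is the new neighbor of \<open>Inl w\<close>.\<close>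

definition corona :: "'a pair_pre_digraph \<Rightarrow> ('a + 'a) pair_pre_digraph" where
  "corona G = \<lparr> pverts = pverts G <+> pverts G,
     parcs = {(Inl u, Inl v) | u v. (u, v) \<in> parcs G}
       \<union> {(Inl w, Inr w) | w. w \<in> pverts G}
       \<union> {(Inr w, Inl w) | w. w \<in> pverts G} \<rparr>"

text \<open>
  Every finite graph has an isomorphic copy on natural numbers, so it suffices to quantify over
  these; see the lemma \<open>is_coronaI\<close> below.
\<close>

definition is_corona :: "'a pair_pre_digraph \<Rightarrow> bool" where
  "is_corona T \<longleftrightarrow> (\<exists>H :: nat pair_pre_digraph. pair_graph H \<and> digraph_iso (with_proj T) (with_proj (corona H)))"


lemma digraph_iso_pairI:
  fixes G :: "'a pair_pre_digraph" and H :: "'b pair_pre_digraph"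
  assumes "pair_wf_digraph G" "inj_on f (pverts G)"
    and "pverts H = f ` pverts G" "parcs H = map_prod f f ` parcs G"
  shows "digraph_iso (with_proj G) (with_proj H)"
proof -
  interpret pair_wf_digraph G by fact
  let ?h = "\<lparr> iso_verts = f, iso_arcs = map_prod f f, iso_head = snd, iso_tail = fst \<rparr>"
  have "inj_on (map_prod f f) (parcs G)"
  proof (rule inj_on_subset)
    show "inj_on (map_prod f f) (pverts G \<times> pverts G)"
      using assms(2) by (rule map_prod_inj_on) (rule assms(2))
    show "parcs G \<subseteq> pverts G \<times> pverts G" by (auto dest: wellformed')
  qed
  then have "pre_digraph.digraph_isomorphism (with_proj G) ?h"
    using assms(2) wf_digraph by (auto simp: pre_digraph.digraph_isomorphism_def)
  moreover have "with_proj H = app_iso ?h (with_proj G)"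
    using assms(3,4) by (simp add: app_iso_def with_proj_def)
  ultimately show ?thesis unfolding digraph_iso_def by blast
qed

lemma pair_graph_corona:
  assumes "pair_graph G"
  shows "pair_graph (corona G)"
proof -
  interpret pair_graph G by fact
  have fin: "finite (pverts (corona G))"
    using pair_finite_verts by (simp add: corona_def)
  have sub: "parcs (corona G) \<subseteq> pverts (corona G) \<times> pverts (corona G)"
    by (auto simp: corona_def dest: wellformed')
  have "finite (parcs (corona G))"
    by (rule finite_subset[OF sub]) (use fin in simp)
  moreover have "sym (parcs (corona G))"
    using pair_sym_arcs by (auto simp: corona_def symmetric_def sym_def)
  moreover have "fst e \<noteq> snd e" if "e \<in> parcs (corona G)" for e
    using that pair_no_loops by (auto simp: corona_def)
  ultimately show ?thesis
    using fin sub by unfold_locales (auto simp: symmetric_def)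
qed

lemma parcs_corona:
  "parcs (corona G) = map_prod Inl Inl ` parcs G
     \<union> (\<lambda>w. (Inl w, Inr w)) ` pverts G \<union> (\<lambda>w. (Inr w, Inl w)) ` pverts G"
  by (auto simp: corona_def)

lemma digraph_iso_corona:
  assumes "pair_graph G" "inj_on f (pverts G)"
  shows "digraph_iso (with_proj (corona G))
    (with_proj (corona \<lparr> pverts = f ` pverts G, parcs = map_prod f f ` parcs G \<rparr>))"
    (is "digraph_iso _ (with_proj (corona ?K))")
proof (rule digraph_iso_pairI[where f = "map_sum f f"])
  show "pair_wf_digraph (corona G)"
    using pair_graph_corona[OF assms(1)]
    by (simp add: pair_graph_def pair_digraph_def pair_fin_digraph_def)
  show "inj_on (map_sum f f) (pverts (corona G))"
    using assms(2) by (auto simp: corona_def intro!: inj_onI dest: inj_onD)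
  show "pverts (corona ?K) = map_sum f f ` pverts (corona G)"
    by (simp add: corona_def Plus_def image_image image_Un)
  show "parcs (corona ?K) = map_prod (map_sum f f) (map_sum f f) ` parcs (corona G)"
    by (simp add: parcs_corona image_Un image_image prod.map_comp o_def)
qed

lemma is_coronaI:
  fixes H :: "'b pair_pre_digraph"
  assumes "pair_graph H" "digraph_iso (with_proj T) (with_proj (corona H))"
  shows "is_corona T"
proof -
  interpret H: pair_graph H by fact
  obtain f :: "'b \<Rightarrow> nat" where f: "inj_on f (pverts H)"
    using finite_imp_inj_to_nat_seg[OF H.pair_finite_verts] by blast
  define K where "K = \<lparr> pverts = f ` pverts H, parcs = map_prod f f ` parcs H \<rparr>"
  have "sym (parcs K)"
    using H.pair_sym_arcs by (fastforce simp: K_def symmetric_def sym_def)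
  moreover have "fst e \<noteq> snd e" if "e \<in> parcs K" for e
    using that f H.pair_no_loops by (force simp: K_def dest: inj_onD H.wellformed')
  ultimately have K: "pair_graph K"
    using H.pair_finite_verts H.pair_finite_arcs
    by unfold_locales (auto simp: K_def symmetric_def dest: H.wellformed')
  have "digraph_iso (with_proj (corona H)) (with_proj (corona K))"
    unfolding K_def using assms(1) f by (rule digraph_iso_corona)
  with assms(2) have "digraph_iso (with_proj T) (with_proj (corona K))" by (rule digraph_iso_trans)
  with K show ?thesis by (auto simp: is_corona_def)
qed

lemma
  assumes "finite (pverts G)"
  shows finite_c4_set: "finite {card (c ` pverts G) | c :: 'a \<Rightarrow> nat. no_rainbow_path 4 G c}"
    and nonempty_c4_set: "{card (c ` pverts G) | c :: 'a \<Rightarrow> nat. no_rainbow_path 4 G c} \<noteq> {}"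
proof -
  show "finite {card (c ` pverts G) | c :: 'a \<Rightarrow> nat. no_rainbow_path 4 G c}"
    by (rule finite_subset[of _ "{..card (pverts G)}"]) (auto intro: card_image_le assms)
  have "no_rainbow_path 4 G (\<lambda>_. 0 :: nat)"
    unfolding no_rainbow_path_def
  proof (intro notI, elim exE conjE)
    fix H :: "'a pair_pre_digraph"
    assume iso: "digraph_iso (with_proj (path_graph 4)) (with_proj H)" and "rainbow (\<lambda>_. 0 :: nat) H"
    then have *: "x = y" if "x \<in> pverts H" "y \<in> pverts H" for x y
      using that by (auto simp: rainbow_def inj_on_def)
    obtain h where h: "pre_digraph.digraph_isomorphism (with_proj (path_graph 4)) h"
      and H: "with_proj H = app_iso h (with_proj (path_graph 4))"
      using iso by (auto simp: digraph_iso_def)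
    have "pverts H = iso_verts h ` {..<4}"
      using arg_cong[OF H, of verts] by (simp add: path_graph_def)
    then have "iso_verts h 0 = iso_verts h 1" by (intro *) auto
    moreover have "inj_on (iso_verts h) {..<4}"
      using h by (simp add: pre_digraph.digraph_isomorphism_def path_graph_def)
    ultimately show False by (auto dest: inj_onD)
  qed
  then show "{card (c ` pverts G) | c :: 'a \<Rightarrow> nat. no_rainbow_path 4 G c} \<noteq> {}" by blast
qed

lemma card_colors_le_c4:
  fixes c :: "'a \<Rightarrow> 'c"
  assumes fin: "finite (pverts G)" and c: "no_rainbow_path 4 G c"
  shows "card (c ` pverts G) \<le> c4 G"
proof -
  obtain f :: "'c \<Rightarrow> nat" where f: "inj_on f (c ` pverts G)"
    using finite_imp_inj_to_nat_seg[of "c ` pverts G"] fin by blast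
  have "rainbow c H" if "rainbow (f \<circ> c) H" for H
    using that by (auto simp: rainbow_def intro: inj_on_imageI2)
  then have "no_rainbow_path 4 G (f \<circ> c)"
    using c by (auto simp: no_rainbow_path_def)
  then have "card ((f \<circ> c) ` pverts G) \<le> c4 G"
    unfolding c4_def using finite_c4_set[OF fin]
    by (intro Max_ge CollectI exI[of _ "f \<circ> c"] conjI) simp_all
  moreover have "(f \<circ> c) ` pverts G = f ` c ` pverts G" by (simp add: image_comp)
  ultimately show ?thesis using card_image[OF f] by simp
qed

end

theory Submission
  imports Defs
begin

text \<open>
  If every path on four vertices meets a set \<open>S\<close> twice, then giving \<open>S\<close> a single color and all
  other vertices distinct colors leaves no rainbow \<open>P\<^sub>4\<close> and uses \<open>n - |S| + 1\<close> colors.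
  Suppose that at most \<open>n/2 + 1\<close> colors are possible. Taking for \<open>S\<close> the sides of the
  bipartition shows that they have equal size. For an edge \<open>uv\<close>, exchange the two sides in the
  component of \<open>v\<close> in \<open>T - u\<close>, so that \<open>u\<close> and \<open>v\<close> fall into the same class. That class can
  serve as \<open>S\<close>. If neither \<open>u\<close> nor \<open>v\<close> is a leaf, the complementary class works as well: give it one color
  on each side of \<open>uv\<close>, and make \<open>u\<close> and \<open>v\<close> share a color. Hence the two classes have
  equal size, which means that the component of \<open>v\<close> is balanced in the original bipartition.
  As a leaf contributes \<open>1\<close> to the side opposite to its neighbor, summing over the components of
  \<open>T - u\<close> for a non-leaf \<open>u\<close> shows that \<open>u\<close> has exactly one leaf neighbor, so \<open>T\<close> is a corona.
\<close>

section \<open>Rainbow copies of the four-vertex path as sequences of vertices\<close>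

lemma no_rainbow_path_4I:
  fixes G :: "'a pair_pre_digraph"
  assumes "\<And>x0 x1 x2 x3. \<lbrakk>(x0, x1) \<in> parcs G; (x1, x2) \<in> parcs G; (x2, x3) \<in> parcs G;
    distinct (map c [x0, x1, x2, x3])\<rbrakk> \<Longrightarrow> False"
  shows "no_rainbow_path 4 G c"
  unfolding no_rainbow_path_def
proof (intro notI, elim exE conjE)
  fix H :: "'a pair_pre_digraph"
  assume sub: "subgraph (with_proj H) (with_proj G)"
    and iso: "digraph_iso (with_proj (path_graph 4)) (with_proj H)" and rainbow: "rainbow c H"
  obtain h where h: "pre_digraph.digraph_isomorphism (with_proj (path_graph 4)) h"
    and H: "with_proj H = app_iso h (with_proj (path_graph 4))"
    using iso by (auto simp: digraph_iso_def)
  let ?x = "iso_verts h"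
  have inj: "inj_on ?x {..<4}"
    using h by (simp add: pre_digraph.digraph_isomorphism_def path_graph_def)
  have verts: "pverts H = ?x ` {..<4}"
    using arg_cong[OF H, of verts] by (simp add: path_graph_def)
  \<comment> \<open>\<open>H\<close> is a pair digraph, so its tail and head maps are the
    projections. An arc of the path is therefore sent to the pair of the images of its ends.\<close>
  have tails: "iso_tail h = fst" and heads: "iso_head h = snd"
    using arg_cong[OF H, of tail] arg_cong[OF H, of head] by (simp_all add: app_iso_def)
  have arcs: "(?x i, ?x (Suc i)) \<in> parcs G" if "i < 3" for i
  proof -
    have e: "(i, Suc i) \<in> parcs (path_graph 4)" using that by (simp add: path_graph_def)
    then have "iso_arcs h (i, Suc i) = (?x i, ?x (Suc i))"
      using h tails heads by (auto simp: pre_digraph.digraph_isomorphism_def prod_eq_iff)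
    moreover have "iso_arcs h (i, Suc i) \<in> parcs H"
      using arg_cong[OF H, of arcs] e by simp
    ultimately show ?thesis using sub by (auto simp: subgraph_def)
  qed
  have "inj_on (c \<circ> ?x) {..<4}"
    using rainbow inj unfolding rainbow_def verts by (intro comp_inj_on)
  then have "inj_on (c \<circ> ?x) (set [0, 1, 2, 3])" by (rule inj_on_subset) auto
  then have "distinct (map (c \<circ> ?x) [0, 1, 2, 3])" unfolding distinct_map by simp
  then have "distinct (map c [?x 0, ?x 1, ?x 2, ?x 3])" by simp
  moreover have "(?x 0, ?x 1) \<in> parcs G" "(?x 1, ?x 2) \<in> parcs G" "(?x 2, ?x 3) \<in> parcs G"
    using arcs[of 0] arcs[of 1] arcs[of 2] by (simp_all add: numeral_eq_Suc)
  ultimately show False using assms by blast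
qed

section \<open>Branches at a vertex and bipartiteness\<close>

definition avoiding :: "'a rel \<Rightarrow> 'a \<Rightarrow> 'a rel" where
  "avoiding E u = {(a, b) \<in> E. a \<noteq> u \<and> b \<noteq> u}"

text \<open>For an edge \<open>uv\<close> of a loop-free symmetric \<open>E\<close>, this is the
  vertex set of the component of \<open>v\<close> after deleting \<open>u\<close>.\<close>

definition branch :: "'a rel \<Rightarrow> 'a \<Rightarrow> 'a \<Rightarrow> 'a set" where
  "branch E u v = (avoiding E u)\<^sup>* `` {v}"

text \<open>Two neighbours of \<open>u\<close> that remain connected after deleting \<open>u\<close> would close a cycle.\<close>

definition acyclic_edges :: "'a rel \<Rightarrow> bool" where
  "acyclic_edges E \<longleftrightarrow>
     (\<forall>u v w. (u, v) \<in> E \<longrightarrow> (u, w) \<in> E \<longrightarrow> w \<in> branch E u v \<longrightarrow> v = w)"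

lemma acyclic_edgesD:
  "\<lbrakk>acyclic_edges E; (u, v) \<in> E; (u, w) \<in> E; w \<in> branch E u v\<rbrakk> \<Longrightarrow> v = w"
  unfolding acyclic_edges_def by blast

lemma branch_self: "v \<in> branch E u v"
  by (simp add: branch_def)

lemma not_in_branch:
  assumes "u \<noteq> v"
  shows "u \<notin> branch E u v"
proof
  assume "u \<in> branch E u v"
  then have "(v, u) \<in> (avoiding E u)\<^sup>*" by (simp add: branch_def)
  then show False using assms by (cases rule: rtranclE) (auto simp: avoiding_def)
qed

lemma branch_step:
  assumes "x \<in> branch E u v" "(x, y) \<in> E" "x \<noteq> u" "y \<noteq> u"
  shows "y \<in> branch E u v"
  using assms by (auto simp: branch_def avoiding_def intro: rtrancl_into_rtrancl)

text \<open>A step that avoids \<open>u\<close> stays in the branch, so an exit must lead to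
  \<open>u\<close>. By acyclicity \<open>v\<close> is the only neighbor of \<open>u\<close> in the
  branch, hence the exit starts at \<open>v\<close>.\<close>

lemma branch_exit:
  assumes "sym E" "acyclic_edges E" "(u, v) \<in> E" "u \<noteq> v"
    and "(x, y) \<in> E" "x \<in> branch E u v" "y \<notin> branch E u v"
  shows "x = v \<and> y = u"
proof -
  have "x \<noteq> u" using assms(4,6) not_in_branch by metis
  then have "y = u" using assms(5-7) branch_step by metis
  then have "(u, x) \<in> E" using assms(1,5) by (auto dest: symD)
  then have "v = x" using acyclic_edgesD[OF assms(2,3) _ assms(6)] by blast
  with \<open>y = u\<close> show ?thesis by simp
qed

lemma acyclic_edges_subset:
  assumes "acyclic_edges E" "F \<subseteq> E"
  shows "acyclic_edges F"
proof -
  have "avoiding F u \<subseteq> avoiding E u" for u using assms(2) by (auto simp: avoiding_def)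
  then have "branch F u v \<subseteq> branch E u v" for u v
    unfolding branch_def using rtrancl_mono by blast
  then show ?thesis using assms unfolding acyclic_edges_def by (meson subsetD)
qed

text \<open>Induction on the edge set: delete one edge \<open>uv\<close>, two-color the rest, and if
  \<open>u\<close> and \<open>v\<close> agree, swap the two colors on the branch of
  \<open>v\<close>.\<close>

lemma acyclic_edges_bipartite:
  fixes E :: "'a rel"
  assumes "finite E" "sym E" "irrefl E" "acyclic_edges E"
  shows "\<exists>s :: 'a \<Rightarrow> bool. \<forall>x y. (x, y) \<in> E \<longrightarrow> s x \<noteq> s y"
  using assms
proof (induction E rule: finite_psubset_induct)
  case (psubset E)
  show ?case
  proof (cases "E = {}")
    case True
    then show ?thesis by simp
  next
    case False
    then obtain u v where uv: "(u, v) \<in> E" by auto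
    let ?F = "E - {(u, v), (v, u)}"
    have "?F \<subset> E" using uv by blast
    moreover have "sym ?F" using psubset.prems(1) by (auto simp: sym_def)
    moreover have "irrefl ?F" using psubset.prems(2) by (auto simp: irrefl_def)
    moreover have "acyclic_edges ?F" using psubset.prems(3) by (rule acyclic_edges_subset) blast
    ultimately have "\<exists>s :: 'a \<Rightarrow> bool. \<forall>x y. (x, y) \<in> ?F \<longrightarrow> s x \<noteq> s y"
      by (rule psubset.IH)
    then obtain s :: "'a \<Rightarrow> bool" where s: "\<forall>x y. (x, y) \<in> ?F \<longrightarrow> s x \<noteq> s y" ..
    have ne: "u \<noteq> v" using uv psubset.prems(2) by (auto simp: irrefl_def)
    let ?D = "branch E u v"
    \<comment> \<open>The branch is taken in \<open>E\<close>, but only \<open>uv\<close> crosses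
      its boundary, and both orientations of \<open>uv\<close> are missing from \<open>?F\<close>.
      The swap therefore preserves properness on \<open>?F\<close>.\<close>
    have D: "x \<in> ?D \<longleftrightarrow> y \<in> ?D" if "(x, y) \<in> ?F" for x y
      using branch_exit[OF psubset.prems(1,3) uv ne, of x y]
        branch_exit[OF psubset.prems(1,3) uv ne, of y x] that psubset.prems(1)
      by (auto dest: symD)
    show ?thesis
    proof (cases "s u = s v")
      case True
      define t where "t x \<longleftrightarrow> s x \<noteq> (x \<in> ?D)" for x
      have "t u \<noteq> t v" using True not_in_branch[OF ne, of E] branch_self[of v E u] by (simp add: t_def)
      moreover have "t x \<noteq> t y" if "(x, y) \<in> ?F" for x y
        using s that D[OF that] by (simp add: t_def)
      ultimately have "\<forall>x y. (x, y) \<in> E \<longrightarrow> t x \<noteq> t y" by blast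
      then show ?thesis by (rule exI[of _ t])
    next
      case False
      then have "\<forall>x y. (x, y) \<in> E \<longrightarrow> s x \<noteq> s y" using s by blast
      then show ?thesis by (rule exI[of _ s])
    qed
  qed
qed

section \<open>Recognizing a corona\<close>

text \<open>The graph induced on \<open>N\<close> is the base graph, and \<open>l w\<close> is the
  pendant vertex at \<open>w\<close>. The isomorphism \<open>f\<close> sends \<open>w\<close> to
  \<open>Inl w\<close> and \<open>l w\<close> to \<open>Inr w\<close>.\<close>

lemma is_corona_matching:
  fixes G :: "'a pair_pre_digraph"
  assumes "pair_graph G" and "N \<subseteq> pverts G" and l: "bij_betw l N (pverts G - N)"
    and edge: "\<And>w y. \<lbrakk>w \<in> N; y \<in> pverts G - N\<rbrakk> \<Longrightarrow> (w, y) \<in> parcs G \<longleftrightarrow> y = l w"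
    and indep: "\<And>x y. \<lbrakk>x \<in> pverts G - N; y \<in> pverts G - N\<rbrakk> \<Longrightarrow> (x, y) \<notin> parcs G"
  shows "is_corona G"
proof -
  interpret pair_graph G by fact
  let ?g = "the_inv_into N l"
  define f where "f x = (if x \<in> N then Inl x else Inr (?g x))" for x
  define H where "H = \<lparr> pverts = N, parcs = parcs G \<inter> N \<times> N \<rparr>"
  have g: "?g x \<in> N" "l (?g x) = x" if "x \<in> pverts G - N" for x
    using that l by (auto simp: bij_betw_def the_inv_into_into f_the_inv_into_f)
  have gl: "?g (l w) = w" "l w \<in> pverts G - N" if "w \<in> N" for w
    using that l by (auto simp: bij_betw_def the_inv_into_f_f)
  have f: "f w = Inl w" "f (l w) = Inr w" if "w \<in> N" for w
    using gl[OF that] that by (auto simp: f_def)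
  have "finite N" "finite (parcs G \<inter> N \<times> N)"
    using pair_finite_verts pair_finite_arcs finite_subset[OF assms(2)] by auto
  moreover have "sym (parcs H)"
    using pair_sym_arcs by (auto simp: H_def symmetric_def sym_def)
  moreover have "fst e \<noteq> snd e" if "e \<in> parcs H" for e
    using that pair_no_loops by (simp add: H_def)
  ultimately have H: "pair_graph H"
    by unfold_locales (auto simp: H_def symmetric_def)
  have "inj_on f (pverts G)"
  proof (rule inj_onI)
    fix x y assume "x \<in> pverts G" "y \<in> pverts G" "f x = f y"
    then consider "x = y" | "x \<in> pverts G - N" "y \<in> pverts G - N" "?g x = ?g y"
      by (auto simp: f_def split: if_splits)
    then show "x = y"
    proof cases
      case 2
      then show ?thesis using g(2) by metis
    qed
  qed
  have "pverts G = N \<union> l ` N" using assms(2) l by (auto simp: bij_betw_def)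
  then have "pverts (corona H) = f ` pverts G"
    using f by (auto simp: corona_def H_def image_Un image_image Plus_def)
  moreover have "parcs (corona H) = map_prod f f ` parcs G" (is "?L = ?R")
  proof
    show "?L \<subseteq> ?R"
    proof
      fix e assume "e \<in> ?L"
      then consider u v where "e = (Inl u, Inl v)" "(u, v) \<in> parcs G" "u \<in> N" "v \<in> N"
        | w where "e = (Inl w, Inr w)" "w \<in> N"
        | w where "e = (Inr w, Inl w)" "w \<in> N"
        by (auto simp: corona_def H_def)
      then show "e \<in> ?R"
      proof cases
        case 1
        then have "e = map_prod f f (u, v)" using f by simp
        then show ?thesis using 1 by blast
      next
        case 2
        then have "e = map_prod f f (w, l w)" using f by simp
        moreover have "(w, l w) \<in> parcs G" using 2 edge gl by blast
        ultimately show ?thesis by blast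
      next
        case 3
        then have "e = map_prod f f (l w, w)" using f by simp
        moreover have "(l w, w) \<in> parcs G" using 3 edge gl arcs_symmetric by blast
        ultimately show ?thesis by blast
      qed
    qed
    show "?R \<subseteq> ?L"
    proof clarsimp
      fix x y assume xy: "(x, y) \<in> parcs G"
      then have V: "x \<in> pverts G" "y \<in> pverts G" by (auto dest: wellformed')
      consider "x \<in> N" "y \<in> N" | "x \<in> N" "y \<notin> N" | "x \<notin> N" "y \<in> N"
        using indep xy V by blast
      then show "(f x, f y) \<in> ?L"
      proof cases
        case 1
        then show ?thesis using xy by (simp add: f corona_def H_def)
      next
        case 2
        then have "y = l x" using xy V edge by blast
        then show ?thesis using 2 by (simp add: f corona_def H_def)
      next
        case 3
        then have "x = l y" using xy V edge arcs_symmetric by blast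
        then show ?thesis using 3 by (simp add: f corona_def H_def)
      qed
    qed
  qed
  ultimately have "digraph_iso (with_proj G) (with_proj (corona H))"
    using pair_wf_digraph \<open>inj_on f (pverts G)\<close> by (intro digraph_iso_pairI)
  with H show ?thesis by (rule is_coronaI)
qed

section \<open>Acyclicity and connectedness of trees in terms of edges\<close>

text \<open>A walk from \<open>v\<close> to \<open>w\<close> avoiding \<open>u\<close> shortens to a
  path that still avoids \<open>u\<close>. If \<open>v\<close> and \<open>w\<close> differ, the arcs
  from \<open>u\<close> to \<open>v\<close> and from \<open>w\<close> back to \<open>u\<close> close
  it to a cycle.\<close>

lemma undirected_tree_acyclic:
  assumes "undirected_tree G"
  shows "acyclic_edges (parcs G)"
  unfolding acyclic_edges_def
proof (intro allI impI)
  fix u v w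
  assume uv: "(u, v) \<in> parcs G" and uw: "(u, w) \<in> parcs G" and w: "w \<in> branch (parcs G) u v"
  interpret pair_graph G using assms by (simp add: undirected_tree_def)
  have "(v, w) \<in> (avoiding (parcs G) u)\<^sup>*" using w by (simp add: branch_def)
  then have "\<exists>p. awalk v p w \<and> set p \<subseteq> avoiding (parcs G) u"
  proof induction
    case base
    then show ?case using uv by (intro exI[of _ "[]"]) (auto simp: awalk_Nil_iff dest: wellformed')
  next
    case (step y z)
    then obtain p where p: "awalk v p y" "set p \<subseteq> avoiding (parcs G) u" by blast
    have yz: "(y, z) \<in> parcs G" using step by (auto simp: avoiding_def)
    then have "awalk y [(y, z)] z" by (auto simp: awalk_simps dest: wellformed')
    with p have "awalk v (p @ [(y, z)]) z" by (blast intro: awalk_appendI)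
    then show ?case using p step by (intro exI[of _ "p @ [(y, z)]"]) auto
  qed
  then obtain p where p: "awalk v p w" "set p \<subseteq> avoiding (parcs G) u" by blast
  let ?q = "awalk_to_apath p"
  have q: "awalk v ?q w" "distinct (awalk_verts v ?q)"
    using apath_awalk_to_apath[OF p(1)] by (auto simp: apath_def)
  have avoids: "fst e \<noteq> u \<and> snd e \<noteq> u" if "e \<in> set ?q" for e
    using awalk_to_apath_subset[OF p(1)] p(2) that by (auto simp: avoiding_def)
  have "u \<noteq> v" using uv no_loops' by blast
  have nu: "u \<notin> set (awalk_verts v ?q)"
  proof (cases "?q = []")
    case True
    then show ?thesis using \<open>u \<noteq> v\<close> by simp
  next
    case False
    then have "snd (last ?q) \<noteq> u" using avoids last_in_set by blast
    moreover have "u \<notin> fst ` set ?q" using avoids by blast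
    ultimately show ?thesis using False unfolding awalk_verts_conv by simp
  qed
  show "v = w"
  proof (rule ccontr)
    assume "v \<noteq> w"
    then have "?q \<noteq> []" using q(1) by (auto simp: awalk_Nil_iff)
    let ?c = "(u, v) # ?q @ [(w, u)]"
    have "awalk w [(w, u)] u"
      using arcs_symmetric[OF uw] by (auto simp: awalk_simps dest: wellformed')
    then have "awalk v (?q @ [(w, u)]) u" using q(1) by (blast intro: awalk_appendI)
    then have c: "awalk u ?c u" using uv by (auto simp: awalk_Cons_iff)
    have "awalk_verts v (?q @ [(w, u)]) = awalk_verts v ?q @ [u]"
      using \<open>awalk v (?q @ [(w, u)]) u\<close> by (subst awalk_verts_append) (use q(1) in auto)
    then have "distinct (tl (awalk_verts u ?c))" using q(2) nu by simp
    then have "cycle ?c" using c unfolding cycle_def by blast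
    \<comment> \<open>The nonempty middle part makes at least three arcs, so \<open>?c\<close> is
      not the closed walk back and forth along one edge.\<close>
    moreover have "length ?c \<ge> 3" using \<open>?q \<noteq> []\<close> by (cases ?q) auto
    ultimately show False using assms unfolding undirected_tree_def by blast
  qed
qed

lemma undirected_tree_connected:
  assumes "undirected_tree G" "x \<in> pverts G" "y \<in> pverts G"
  shows "(x, y) \<in> (parcs G)\<^sup>*"
proof -
  interpret pair_graph G using assms by (simp add: undirected_tree_def)
  have "strongly_connected (with_proj G)"
    using assms pair_sym_arcs unfolding undirected_tree_def
    by (intro symmetric_connected_imp_strongly_connected) auto
  then have "x \<rightarrow>\<^sup>*\<^bsub>with_proj G\<^esub> y" using assms by auto
  then show ?thesis using reachable_rtranclI by fastforce
qed

section \<open>Lower bounds from explicit colorings\<close>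

text \<open>Colors are counted through a set \<open>R\<close> of differently colored
  representatives, so the full image of \<open>c\<close> need not be computed.\<close>

lemma c4_ge_card_transversal:
  fixes G :: "'a pair_pre_digraph" and c :: "'a \<Rightarrow> 'b"
  assumes "finite (pverts G)" "R \<subseteq> pverts G" "inj_on c R"
    and "\<And>x0 x1 x2 x3. \<lbrakk>(x0, x1) \<in> parcs G; (x1, x2) \<in> parcs G; (x2, x3) \<in> parcs G;
      distinct (map c [x0, x1, x2, x3])\<rbrakk> \<Longrightarrow> False"
  shows "card R \<le> c4 G"
proof -
  have "card R = card (c ` R)" using assms(3) by (simp add: card_image)
  also have "\<dots> \<le> card (c ` pverts G)" using assms(1,2) by (intro card_mono) auto
  also have "\<dots> \<le> c4 G"
    using assms(1) by (rule card_colors_le_c4) (rule no_rainbow_path_4I, rule assms(4))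
  finally show ?thesis .
qed

lemma c4_ge_one_class:
  fixes G :: "'a pair_pre_digraph"
  assumes "finite (pverts G)" "S \<subseteq> pverts G" "S \<noteq> {}"
    and two: "\<And>x0 x1 x2 x3. \<lbrakk>(x0, x1) \<in> parcs G; (x1, x2) \<in> parcs G; (x2, x3) \<in> parcs G;
      distinct [x0, x1, x2, x3]\<rbrakk> \<Longrightarrow> \<exists>x y. {x, y} \<subseteq> {x0, x1, x2, x3} \<inter> S \<and> x \<noteq> y"
  shows "card (pverts G - S) + 1 \<le> c4 G"
proof -
  obtain r where r: "r \<in> S" using assms(3) by blast
  \<comment> \<open>Vertices serve as colors: \<open>r\<close> represents all of \<open>S\<close>,
    and every other vertex keeps its own color. The shared color is the \<open>+ 1\<close> in the
    bound.\<close>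
  define c where "c x = (if x \<in> S then r else x)" for x
  let ?R = "insert r (pverts G - S)"
  have "card ?R \<le> c4 G"
  proof (rule c4_ge_card_transversal[where c = c])
    show "?R \<subseteq> pverts G" using assms(2) r by blast
    show "inj_on c ?R" using r by (auto simp: inj_on_def c_def)
  next
    fix x0 x1 x2 x3
    assume edges: "(x0, x1) \<in> parcs G" "(x1, x2) \<in> parcs G" "(x2, x3) \<in> parcs G"
      and dist: "distinct (map c [x0, x1, x2, x3])"
    then have "distinct [x0, x1, x2, x3]" unfolding distinct_map by blast
    then obtain x y where "{x, y} \<subseteq> {x0, x1, x2, x3}" "x \<in> S" "y \<in> S" "x \<noteq> y"
      using two[OF edges] by blast
    then show False using dist by (auto simp: c_def)
  qed (fact assms(1))
  moreover have "card ?R = card (pverts G - S) + 1" using r assms(1) by simp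
  ultimately show ?thesis by simp
qed

text \<open>\<open>S1\<close> and \<open>S2\<close> get one color each, which adds two, while the
  common color of \<open>u\<close> and \<open>v\<close> costs one. The net gain is the same
  \<open>+ 1\<close> as with a single class.\<close>

lemma c4_ge_two_classes:
  fixes G :: "'a pair_pre_digraph"
  assumes "finite (pverts G)" "S1 \<union> S2 \<subseteq> pverts G" "S1 \<noteq> {}" "S2 \<noteq> {}" "S1 \<inter> S2 = {}"
    and uv: "u \<in> pverts G - S1 - S2" "v \<in> pverts G - S1 - S2" "u \<noteq> v"
    and two: "\<And>x0 x1 x2 x3. \<lbrakk>(x0, x1) \<in> parcs G; (x1, x2) \<in> parcs G; (x2, x3) \<in> parcs G;
      distinct [x0, x1, x2, x3]\<rbrakk> \<Longrightarrow> \<exists>x y. {x, y} \<subseteq> {x0, x1, x2, x3} \<and> x \<noteq> y \<and>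
        ({x, y} \<subseteq> S1 \<or> {x, y} \<subseteq> S2 \<or> {x, y} = {u, v})"
  shows "card (pverts G - S1 - S2) + 1 \<le> c4 G"
proof -
  obtain r1 r2 where r: "r1 \<in> S1" "r2 \<in> S2" using assms(3,4) by blast
  define c where "c x = (if x \<in> S1 then r1 else if x \<in> S2 then r2 else if x = v then u else x)" for x
  let ?W = "pverts G - S1 - S2"
  let ?R = "insert r1 (insert r2 (?W - {v}))"
  have "r1 \<noteq> r2" using r assms(5) by blast
  have "card ?R \<le> c4 G"
  proof (rule c4_ge_card_transversal[where c = c])
    show "?R \<subseteq> pverts G" using assms(2) r by blast
    have "c x = x" if "x \<in> ?R" for x using that r assms(5) by (auto simp: c_def)
    then show "inj_on c ?R" by (metis inj_onI)
  next
    fix x0 x1 x2 x3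
    assume edges: "(x0, x1) \<in> parcs G" "(x1, x2) \<in> parcs G" "(x2, x3) \<in> parcs G"
      and dist: "distinct (map c [x0, x1, x2, x3])"
    then have "distinct [x0, x1, x2, x3]" unfolding distinct_map by blast
    then obtain x y where xy: "{x, y} \<subseteq> {x0, x1, x2, x3}" "x \<noteq> y"
      and "{x, y} \<subseteq> S1 \<or> {x, y} \<subseteq> S2 \<or> {x, y} = {u, v}"
      using two[OF edges] by blast
    then have "c x = c y" using uv assms(5) by (auto simp: c_def doubleton_eq_iff)
    then show False using dist xy by auto
  qed (fact assms(1))
  moreover have "card ?R = card ?W + 1"
  proof -
    have "card (?W - {v}) = card ?W - 1" "card ?W > 0"
      using uv(2) assms(1) by (auto simp: card_gt_0_iff)
    then show ?thesis using r \<open>r1 \<noteq> r2\<close> assms(1) by simp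
  qed
  ultimately show ?thesis by simp
qed

section \<open>Leaves and signed counts\<close>

definition leaf :: "'a rel \<Rightarrow> 'a \<Rightarrow> bool" where
  "leaf E x \<longleftrightarrow> (\<exists>!y. (x, y) \<in> E)"

lemma leafD: "\<lbrakk>leaf E x; (x, y) \<in> E; (x, z) \<in> E\<rbrakk> \<Longrightarrow> y = z"
  unfolding leaf_def by blast

lemma not_leafE:
  assumes "\<not> leaf E x" "(x, y) \<in> E"
  obtains z where "(x, z) \<in> E" "z \<noteq> y"
  using assms unfolding leaf_def by metis

lemma sum_pm_one:
  assumes "finite A"
  shows "(\<Sum>x\<in>A. if P x then 1 else -1 :: int) = 2 * int (card {x \<in> A. P x}) - int (card A)"
proof -
  have "(\<Sum>x\<in>A. if P x then 1 else -1 :: int) = (\<Sum>x\<in>A. 2 * of_bool (P x) - 1)"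
    by (rule sum.cong) auto
  also have "\<dots> = 2 * (\<Sum>x\<in>A. of_bool (P x)) - int (card A)"
    by (simp add: sum_subtractf sum_distrib_left)
  finally show ?thesis using assms by (simp add: Int_def)
qed

section \<open>Trees with a fixed bipartition, decomposed at a vertex\<close>

locale tree_graph = pair_graph G for G :: "'a pair_pre_digraph" +
  fixes s :: "'a \<Rightarrow> bool"
  assumes acyclic: "acyclic_edges (parcs G)"
    and connected: "\<lbrakk>x \<in> pverts G; y \<in> pverts G\<rbrakk> \<Longrightarrow> (x, y) \<in> (parcs G)\<^sup>*"
    and proper: "(x, y) \<in> parcs G \<Longrightarrow> s x \<noteq> s y"
begin

abbreviation "E \<equiv> parcs G"
abbreviation "V \<equiv> pverts G"

definition sign :: "'a \<Rightarrow> int" where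
  "sign x = (if s x then 1 else -1)"

lemma sym_E: "sym E"
  using arcs_symmetric by (auto intro: symI)

lemma edge_neq: "(x, y) \<in> E \<Longrightarrow> x \<noteq> y"
  using no_loops' by blast

lemma neighbours_subset: "{v. (u, v) \<in> E} \<subseteq> V"
  by (auto dest: wellformed')

lemma finite_neighbours: "finite {v. (u, v) \<in> E}"
  using neighbours_subset pair_finite_verts by (rule finite_subset)

lemma branch_subset:
  assumes "(u, v) \<in> E"
  shows "branch E u v \<subseteq> V"
proof
  fix x assume "x \<in> branch E u v"
  then have "(v, x) \<in> (avoiding E u)\<^sup>*" by (simp add: branch_def)
  then show "x \<in> V" by induction (use assms in \<open>auto simp: avoiding_def dest: wellformed'\<close>)
qed

text \<open>A common vertex would, by symmetry of the edges, connect \<open>v\<close> to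
  \<open>w\<close> without passing through \<open>u\<close>, against acyclicity.\<close>

lemma branches_disjoint:
  assumes "(u, v) \<in> E" "(u, w) \<in> E" "v \<noteq> w"
  shows "branch E u v \<inter> branch E u w = {}"
proof (rule ccontr)
  assume "branch E u v \<inter> branch E u w \<noteq> {}"
  then obtain x where x: "(v, x) \<in> (avoiding E u)\<^sup>*" "(w, x) \<in> (avoiding E u)\<^sup>*"
    by (auto simp: branch_def)
  have "sym (avoiding E u)" using sym_E by (auto simp: avoiding_def sym_def)
  then have "(x, w) \<in> (avoiding E u)\<^sup>*" using x(2) by (meson sym_rtrancl symD)
  with x(1) have "w \<in> branch E u v" by (auto simp: branch_def)
  then show False using acyclic_edgesD[OF acyclic assms(1,2)] assms(3) by blast
qed

lemma branches_cover:
  assumes "u \<in> V"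
  shows "V = insert u (\<Union>v\<in>{v. (u, v) \<in> E}. branch E u v)" (is "_ = insert u ?B")
proof
  show "insert u ?B \<subseteq> V" using assms branch_subset by blast
  show "V \<subseteq> insert u ?B"
  proof
    fix x assume "x \<in> V"
    then have "(u, x) \<in> E\<^sup>*" using assms connected by blast
    then show "x \<in> insert u ?B"
    proof induction
      case base
      then show ?case by simp
    next
      case (step y z)
      \<comment> \<open>Along a walk from \<open>u\<close>, a step out of \<open>u\<close> enters a
        branch at its root, and any other step stays in the branch or returns to
        \<open>u\<close>.\<close>
      then show ?case using branch_self[of z E u] branch_step[of y E u _ z] by blast
    qed
  qed
qed

lemma branch_leaf:
  assumes "(u, v) \<in> E" "leaf E v"
  shows "branch E u v = {v}"
proof -
  have "x = v" if "(v, x) \<in> (avoiding E u)\<^sup>*" for x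
    using that
  proof induction
    case (step y z)
    then have "(v, z) \<in> E" "z \<noteq> u" by (auto simp: avoiding_def)
    then show ?case using leafD[OF assms(2) _ arcs_symmetric[OF assms(1)]] by blast
  qed simp
  then show ?thesis using branch_self by (auto simp: branch_def)
qed

lemma neighbour_exists:
  assumes "card V \<ge> 2" "x \<in> V"
  shows "\<exists>y. (x, y) \<in> E"
proof -
  have "V \<noteq> {x}" using assms by auto
  then obtain z where "z \<in> V" "z \<noteq> x" using assms by blast
  then have "(x, z) \<in> E\<^sup>*" using connected assms by blast
  then show ?thesis using \<open>z \<noteq> x\<close> by (auto elim: converse_rtranclE)
qed

lemma sum_branches:
  fixes f :: "'a \<Rightarrow> int"
  assumes "u \<in> V"
  shows "sum f V = f u + (\<Sum>v | (u, v) \<in> E. sum f (branch E u v))"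
proof -
  have fin: "finite (branch E u v)" if "(u, v) \<in> E" for v
    using branch_subset[OF that] pair_finite_verts by (rule finite_subset)
  have "u \<notin> (\<Union>v\<in>{v. (u, v) \<in> E}. branch E u v)"
    using not_in_branch edge_neq by fast
  then have "sum f V = f u + sum f (\<Union>v\<in>{v. (u, v) \<in> E}. branch E u v)"
    using branches_cover[OF assms] fin finite_neighbours by (subst branches_cover[OF assms]) simp
  also have "sum f (\<Union>v\<in>{v. (u, v) \<in> E}. branch E u v)
      = (\<Sum>v | (u, v) \<in> E. sum f (branch E u v))"
    using finite_neighbours fin branches_disjoint by (intro sum.UNION_disjoint) auto
  finally show ?thesis .
qed

text \<open>A path on four vertices alternates between the sides, so it has two vertices on the side
  \<open>b\<close>, which serves as the single class. The vertex \<open>x\<close> makes this side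
  nonempty.\<close>

lemma c4_ge_side:
  assumes "x \<in> V" "s x = b"
  shows "card {x \<in> V. s x \<noteq> b} + 1 \<le> c4 G"
proof -
  have "card (V - {x \<in> V. s x = b}) + 1 \<le> c4 G"
  proof (rule c4_ge_one_class)
    fix x0 x1 x2 x3
    assume e: "(x0, x1) \<in> E" "(x1, x2) \<in> E" "(x2, x3) \<in> E" "distinct [x0, x1, x2, x3]"
    have "x0 \<in> V" "x1 \<in> V" "x2 \<in> V" "x3 \<in> V" using e wellformed' by blast+
    moreover have "s x0 = s x2" "s x1 = s x3" "s x0 \<noteq> s x1"
      using e proper by blast+
    ultimately have "{x1, x3} \<subseteq> {x \<in> V. s x = b} \<or> {x0, x2} \<subseteq> {x \<in> V. s x = b}" by auto
    then show "\<exists>x y. {x, y} \<subseteq> {x0, x1, x2, x3} \<inter> {x \<in> V. s x = b} \<and> x \<noteq> y"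
      using e(4) by auto
  qed (use assms pair_finite_verts in auto)
  moreover have "V - {x \<in> V. s x = b} = {x \<in> V. s x \<noteq> b}" by blast
  ultimately show ?thesis by simp
qed

section \<open>Swapping the sides beyond an edge\<close>

context
  fixes u v :: 'a
  assumes edge: "(u, v) \<in> E"
begin

text \<open>Swapping the two sides beyond the edge \<open>uv\<close> makes its ends agree; every path not using
  both \<open>u\<close> and \<open>v\<close> still alternates.\<close>

definition flip :: "'a \<Rightarrow> bool" where
  "flip x \<longleftrightarrow> s x \<noteq> (x \<in> branch E u v)"

lemma u_notin: "u \<notin> branch E u v"
  using not_in_branch edge_neq edge by metis

lemma flip_ends: "flip u = flip v"
  using u_notin branch_self[of v E u] proper[OF edge] by (auto simp: flip_def)

lemma branch_crossing:
  assumes "(x, y) \<in> E" "x \<in> branch E u v \<longleftrightarrow> y \<notin> branch E u v"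
  shows "{x, y} = {u, v}"
  using branch_exit[OF sym_E acyclic edge edge_neq[OF edge], of x y]
    branch_exit[OF sym_E acyclic edge edge_neq[OF edge], of y x] assms arcs_symmetric
  by blast

text \<open>Only the edge \<open>uv\<close> crosses the boundary of the branch, so a path without
  both ends lies on one side of it. There \<open>flip\<close> equals \<open>s\<close> or its
  negation throughout and hence alternates.\<close>

lemma path_cases:
  assumes "(x0, x1) \<in> E" "(x1, x2) \<in> E" "(x2, x3) \<in> E"
  obtains (crossing) "{u, v} \<subseteq> {x0, x1, x2, x3}"
  | (left) "{x0, x1, x2, x3} \<subseteq> branch E u v" "flip x0 = flip x2" "flip x1 = flip x3" "flip x0 \<noteq> flip x1"
  | (right) "{x0, x1, x2, x3} \<inter> branch E u v = {}" "flip x0 = flip x2" "flip x1 = flip x3" "flip x0 \<noteq> flip x1"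
proof -
  have "s x0 \<noteq> s x1" "s x1 \<noteq> s x2" "s x2 \<noteq> s x3" using assms proper by blast+
  then show thesis
    using that branch_crossing[OF assms(1)] branch_crossing[OF assms(2)] branch_crossing[OF assms(3)]
    unfolding flip_def by (cases "x0 \<in> branch E u v"; cases "x1 \<in> branch E u v";
        cases "x2 \<in> branch E u v"; cases "x3 \<in> branch E u v") auto
qed

text \<open>The single class is that of \<open>u\<close> and \<open>v\<close>. A path containing
  both ends meets it in these two vertices, and any other path alternates.\<close>

lemma c4_ge_flip_different:
  "card {x \<in> V. flip x \<noteq> flip u} + 1 \<le> c4 G"
proof -
  let ?S = "{x \<in> V. flip x = flip u}"
  have "card (V - ?S) + 1 \<le> c4 G"
  proof (rule c4_ge_one_class)
    fix x0 x1 x2 x3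
    assume e: "(x0, x1) \<in> E" "(x1, x2) \<in> E" "(x2, x3) \<in> E" "distinct [x0, x1, x2, x3]"
    have V: "x0 \<in> V" "x1 \<in> V" "x2 \<in> V" "x3 \<in> V" using e wellformed' by blast+
    show "\<exists>x y. {x, y} \<subseteq> {x0, x1, x2, x3} \<inter> ?S \<and> x \<noteq> y"
    proof (cases rule: path_cases[OF e(1-3)])
      case 1
      then show ?thesis using flip_ends edge_neq[OF edge] wellformed'[OF edge]
        by (intro exI[of _ u] exI[of _ v]) simp
    next
      case 2
      then have "{x1, x3} \<subseteq> ?S \<or> {x0, x2} \<subseteq> ?S" using V by auto
      then show ?thesis using e(4) by auto
    next
      case 3
      then have "{x1, x3} \<subseteq> ?S \<or> {x0, x2} \<subseteq> ?S" using V by auto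
      then show ?thesis using e(4) by auto
    qed
  qed (use edge wellformed' pair_finite_verts in auto)
  moreover have "V - ?S = {x \<in> V. flip x \<noteq> flip u}" by blast
  ultimately show ?thesis by simp
qed

text \<open>Here the class opposite to \<open>u\<close> and \<open>v\<close> is merged, with
  separate colors inside and outside the branch. A path through both \<open>u\<close> and
  \<open>v\<close> is handled by their common color. The color lost there is regained because both
  parts of the class are nonempty.\<close>

lemma c4_ge_flip_same:
  assumes "\<not> leaf E u" "\<not> leaf E v"
  shows "card {x \<in> V. flip x = flip u} + 1 \<le> c4 G"
proof -
  let ?D = "branch E u v"
  let ?S1 = "{x \<in> V. x \<in> ?D \<and> flip x \<noteq> flip u}" and ?S2 = "{x \<in> V. x \<notin> ?D \<and> flip x \<noteq> flip u}"
  have uv: "u \<in> V" "v \<in> V" "u \<noteq> v" using edge wellformed' edge_neq by blast+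
  obtain y where y: "(u, y) \<in> E" "y \<noteq> v" using not_leafE[OF assms(1) edge] .
  obtain z where z: "(v, z) \<in> E" "z \<noteq> u"
    using not_leafE[OF assms(2) arcs_symmetric[OF edge]] .
  \<comment> \<open>Further neighbors \<open>y\<close> of \<open>u\<close> and \<open>z\<close> of
    \<open>v\<close> exist since neither end is a leaf. They stay on their own sides of
    \<open>uv\<close> and so witness that \<open>?S2\<close> and \<open>?S1\<close> are
    nonempty.\<close>
  have "y \<notin> ?D" using branch_crossing[OF y(1)] u_notin y by (auto simp: doubleton_eq_iff)
  then have "y \<in> ?S2" using proper[OF y(1)] u_notin wellformed'[OF y(1)] by (auto simp: flip_def)
  have "z \<in> ?D" using branch_crossing[OF z(1)] branch_self[of v E u] z by (auto simp: doubleton_eq_iff)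
  then have "z \<in> ?S1"
    using proper[OF z(1)] branch_self[of v E u] wellformed'[OF z(1)] flip_ends by (auto simp: flip_def)
  have "card (V - ?S1 - ?S2) + 1 \<le> c4 G"
  proof (rule c4_ge_two_classes[of G _ _ u v])
    fix x0 x1 x2 x3
    assume e: "(x0, x1) \<in> E" "(x1, x2) \<in> E" "(x2, x3) \<in> E" "distinct [x0, x1, x2, x3]"
    have V: "x0 \<in> V" "x1 \<in> V" "x2 \<in> V" "x3 \<in> V" using e wellformed' by blast+
    show "\<exists>x y. {x, y} \<subseteq> {x0, x1, x2, x3} \<and> x \<noteq> y \<and>
        ({x, y} \<subseteq> ?S1 \<or> {x, y} \<subseteq> ?S2 \<or> {x, y} = {u, v})"
    proof (cases rule: path_cases[OF e(1-3)])
      case 1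
      then show ?thesis using uv by (intro exI[of _ u] exI[of _ v]) simp
    next
      case 2
      then have "{x1, x3} \<subseteq> ?S1 \<or> {x0, x2} \<subseteq> ?S1" using V by auto
      then show ?thesis using e(4) by auto
    next
      case 3
      then have "{x1, x3} \<subseteq> ?S2 \<or> {x0, x2} \<subseteq> ?S2" using V by auto
      then show ?thesis using e(4) by auto
    qed
  qed (use uv pair_finite_verts \<open>y \<in> ?S2\<close> \<open>z \<in> ?S1\<close> flip_ends in auto)
  moreover have "V - ?S1 - ?S2 = {x \<in> V. flip x = flip u}" by blast
  ultimately show ?thesis by simp
qed

text \<open>Swapping negates \<open>sign\<close> on the branch, which subtracts twice the sum over
  it. The factor \<open>sign u\<close> normalizes the class of \<open>u\<close> to \<open>1\<close>,
  as \<open>u\<close> itself is not swapped.\<close>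

lemma sum_flip:
  "(\<Sum>x\<in>V. if flip x = flip u then 1 else -1) = sign u * (sum sign V - 2 * sum sign (branch E u v))"
proof -
  let ?D = "branch E u v"
  have D: "?D \<subseteq> V" using branch_subset[OF edge] .
  have "(\<Sum>x\<in>V. if flip x = flip u then 1 else -1)
      = (\<Sum>x\<in>V. sign u * (sign x - 2 * (if x \<in> ?D then sign x else 0)))"
    using u_notin by (intro sum.cong) (auto simp: flip_def sign_def)
  also have "\<dots> = sign u * (sum sign V - 2 * (\<Sum>x\<in>V. if x \<in> ?D then sign x else 0))"
    by (simp only: sum_distrib_left[symmetric] sum_subtractf)
  also have "(\<Sum>x\<in>V. if x \<in> ?D then sign x else 0) = sum sign ?D"
    using D pair_finite_verts by (subst sum.inter_restrict[symmetric]) (auto simp: Int_absorb1)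
  finally show ?thesis .
qed

end

section \<open>Balance forced by having few colors\<close>

context
  assumes few_colours: "2 * c4 G \<le> card V + 2"
begin

text \<open>The ends of an edge show that both sides are nonempty. Each side then has at most half
  of the vertices, so both have exactly half.\<close>

lemma sum_sign_zero:
  assumes "(u, v) \<in> E"
  shows "sum sign V = 0"
proof -
  have "card {x \<in> V. s x \<noteq> b} + 1 \<le> c4 G" for b
    using c4_ge_side[of u b] c4_ge_side[of v b] assms proper[OF assms] wellformed'[OF assms] by metis
  from this[of False] this[of True]
  have "2 * card {x \<in> V. s x} \<le> card V" "2 * card {x \<in> V. \<not> s x} \<le> card V"
    using few_colours by simp_all
  moreover have "card V = card {x \<in> V. s x} + card {x \<in> V. \<not> s x}"
    using pair_finite_verts by (subst card_Un_disjoint[symmetric]) (auto intro: arg_cong[of _ _ card])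
  ultimately show ?thesis
    unfolding sign_def sum_pm_one[OF pair_finite_verts] by linarith
qed

text \<open>The two bounds from \<open>flip\<close> leave each of its classes at most half of the
  vertices. Its signed sum therefore vanishes, as does that of \<open>s\<close>, and their
  difference isolates the branch.\<close>

lemma sum_branch_nonleaf:
  assumes "(u, v) \<in> E" "\<not> leaf E u" "\<not> leaf E v"
  shows "sum sign (branch E u v) = 0"
proof -
  let ?t = "flip u v"
  have "card V = card {x \<in> V. ?t x = ?t u} + card {x \<in> V. ?t x \<noteq> ?t u}"
    using pair_finite_verts by (subst card_Un_disjoint[symmetric]) (auto intro: arg_cong[of _ _ card])
  then have "2 * card {x \<in> V. ?t x = ?t u} = card V"
    using c4_ge_flip_different[OF assms(1)] c4_ge_flip_same[OF assms] few_colours by linarith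
  then have "sign u * (sum sign V - 2 * sum sign (branch E u v)) = 0"
    unfolding sum_flip[OF assms(1), symmetric] sum_pm_one[OF pair_finite_verts] by linarith
  then show ?thesis using sum_sign_zero[OF assms(1)] by (auto simp: sign_def split: if_splits)
qed

text \<open>In the sum over the branches at \<open>u\<close> only leaves contribute, each with the
  sign opposite to \<open>u\<close>. The total \<open>0\<close> is thus \<open>sign u\<close> times
  one minus the number of leaf neighbors.\<close>

lemma unique_leaf:
  assumes "(u, w) \<in> E" "\<not> leaf E u"
  shows "\<exists>!v. (u, v) \<in> E \<and> leaf E v"
proof -
  have "u \<in> V" using assms wellformed' by blast
  have "sum sign (branch E u v) = - sign u * of_bool (leaf E v)" if "(u, v) \<in> E" for v
  proof (cases "leaf E v")
    case True
    then show ?thesis using branch_leaf[OF that] proper[OF that] by (simp add: sign_def)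
  next
    case False
    then show ?thesis using sum_branch_nonleaf[OF that assms(2)] by simp
  qed
  then have "sum sign V = sign u + (\<Sum>v | (u, v) \<in> E. - sign u * of_bool (leaf E v))"
    unfolding sum_branches[OF \<open>u \<in> V\<close>] by simp
  also have "\<dots> = sign u * (1 - (\<Sum>v | (u, v) \<in> E. of_bool (leaf E v)))"
    by (simp add: sum_distrib_left[symmetric] sum_negf algebra_simps)
  also have "(\<Sum>v | (u, v) \<in> E. of_bool (leaf E v) :: int) = int (card {v. (u, v) \<in> E \<and> leaf E v})"
    using finite_neighbours by (simp add: Int_def)
  finally have "card {v. (u, v) \<in> E \<and> leaf E v} = 1"
    using sum_sign_zero[OF assms(1)] by (auto simp: sign_def split: if_splits)
  then obtain v where "{v. (u, v) \<in> E \<and> leaf E v} = {v}" by (rule card_1_singletonE)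
  then have "(u, x) \<in> E \<and> leaf E x \<longleftrightarrow> x = v" for x by blast
  then show ?thesis by simp
qed

text \<open>Two adjacent leaves already form the whole tree, which is then the corona of one vertex.
  Otherwise the non-leaves induce the base graph, and each is matched with its unique leaf
  neighbor.\<close>

lemma is_corona_few_colours:
  assumes "card V \<ge> 2"
  shows "is_corona G"
proof (cases "\<exists>x y. (x, y) \<in> E \<and> leaf E x \<and> leaf E y")
  case True
  then obtain x y where xy: "(x, y) \<in> E" "leaf E x" "leaf E y" by blast
  have yx: "(y, x) \<in> E" using arcs_symmetric[OF xy(1)] .
  have "z \<in> {x, y}" if "(x, z) \<in> E\<^sup>*" for z
    using that
  proof induction
    case (step z z')
    then show ?case using leafD[OF xy(2) _ xy(1)] leafD[OF xy(3) _ yx] by blast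
  qed simp
  then have V: "V = {x, y}" using connected wellformed'[OF xy(1)] by blast
  have neq: "x \<noteq> y" using edge_neq[OF xy(1)] .
  have "pair_graph G" by unfold_locales
  then show ?thesis
    by (rule is_corona_matching[where N = "{x}" and l = "\<lambda>_. y"])
      (use V neq xy(1) edge_neq in \<open>auto simp: bij_betw_def\<close>)
next
  case False
  define N where "N = {x \<in> V. \<not> leaf E x}"
  define l where "l x = (THE y. (x, y) \<in> E \<and> leaf E y)" for x
  have uniq: "\<exists>!y. (x, y) \<in> E \<and> leaf E y" if "x \<in> N" for x
  proof -
    have "x \<in> V" "\<not> leaf E x" using that by (simp_all add: N_def)
    moreover obtain w where "(x, w) \<in> E" using neighbour_exists[OF assms \<open>x \<in> V\<close>] by blast
    ultimately show ?thesis using unique_leaf by blast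
  qed
  have l: "(x, l x) \<in> E" "leaf E (l x)" if "x \<in> N" for x
    using theI'[OF uniq[OF that]] unfolding l_def by auto
  have l_eq: "y = l x" if "x \<in> N" "(x, y) \<in> E" "leaf E y" for x y
    using uniq[OF that(1)] l[OF that(1)] that by blast
  have "pair_graph G" by unfold_locales
  then show ?thesis
  proof (rule is_corona_matching[where N = N and l = l])
    show "bij_betw l N (V - N)"
    proof (rule bij_betw_imageI)
      show "inj_on l N"
      proof (rule inj_onI)
        fix x y assume "x \<in> N" "y \<in> N" "l x = l y"
        then show "x = y"
          \<comment> \<open>The leaf \<open>l x = l y\<close> is adjacent to both \<open>x\<close>
            and \<open>y\<close> but has only one neighbor.\<close>
          using leafD[OF l(2)[of x], of x y] l(1)[of x] l(1)[of y] arcs_symmetric by metis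
      qed
      show "l ` N = V - N"
      proof
        show "l ` N \<subseteq> V - N" using l by (auto simp: N_def dest: wellformed')
        show "V - N \<subseteq> l ` N"
        proof
          fix y assume y: "y \<in> V - N"
          then obtain x where x: "(x, y) \<in> E" using neighbour_exists[OF assms] arcs_symmetric by blast
          have "leaf E y" using y by (simp add: N_def)
          then have "x \<in> N" using x False wellformed'[OF x] by (auto simp: N_def)
          then show "y \<in> l ` N" using l_eq x \<open>leaf E y\<close> by blast
        qed
      qed
    qed
  next
    fix w y assume "w \<in> N" "y \<in> V - N"
    then show "(w, y) \<in> E \<longleftrightarrow> y = l w" using l l_eq by (auto simp: N_def)
  next
    fix x y assume "x \<in> V - N" "y \<in> V - N"
    then show "(x, y) \<notin> E" using False by (auto simp: N_def)
  qed (auto simp: N_def)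
qed

end

end

theorem theorem6:
  fixes T :: "'a pair_pre_digraph" and n :: nat
  assumes "undirected_tree T"
    and "card (pverts T) = n"
    and "n \<ge> 2"
    and "\<not> is_corona T"
  shows "real (c4 T) > real n / 2 + 1"
proof (rule ccontr)
  assume "\<not> ?thesis"
  then have few: "2 * c4 T \<le> card (pverts T) + 2" using assms(2) by linarith
  interpret T: pair_graph T using assms(1) by (simp add: undirected_tree_def)
  have acyclic: "acyclic_edges (parcs T)" using assms(1) by (rule undirected_tree_acyclic)
  have "sym (parcs T)" "irrefl (parcs T)"
    using T.arcs_symmetric T.no_loops' by (auto simp: sym_def irrefl_def)
  then have "\<exists>s :: 'a \<Rightarrow> bool. \<forall>x y. (x, y) \<in> parcs T \<longrightarrow> s x \<noteq> s y"
    using T.pair_finite_arcs acyclic by (intro acyclic_edges_bipartite)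
  then obtain s :: "'a \<Rightarrow> bool" where s: "\<forall>x y. (x, y) \<in> parcs T \<longrightarrow> s x \<noteq> s y" ..
  interpret tree_graph T s
    using acyclic s[rule_format] undirected_tree_connected[OF assms(1)] by unfold_locales
  show False using is_corona_few_colours[OF few] assms by simp
qed

end
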